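(* Let $1 \le r \le n/2$ and consider MaintainOPT with known matroid on the uniform matroid of rank $r$ on $n$ elements with pairwise distinct positive weights. For $j = 1,\dots,n$ let $R_j$ be the number of postponements of the $j$-th best (highest-weight) candidate. Then there is an absolute constant $C$ (independent of $n, r, j$ and the weights) such that \[ \mathbb{E}[R_j] \le \begin{cases} \ln\left(\frac{n-j}{r-j+1}\right) + C, & j = 1,\dots,r,\\[4pt] \ln\left(\frac{j-1}{j-r}\right) + C, & j = r+1,\dots,n. \end{cases} \]
   Context: Postponement variant: a pool initially contains all $n$ candidates; in each step a uniformly random candidate from the pool arrives, revealing its weight at its first arrival; the algorithm accepts, rejects (both irrevocable, removing it from the pool) or postpones it (returning it to the pool); a postponement of a candidate is an arrival of it at which it is postponed. The uniform matroid of rank $r$: the feasible sets are all sets of at most $r$ candidates; the goal is a maximum-weight basis (the $r$ highest-weight candidates). MaintainOPT with known matroid: when a candidate $e$ arrives, let $K$ be the set of candidates seen so far and $I^*_K$ the maximum-weight independent subset of $K$ (its $\min(r,|K|)$ best elements); if $e \notin I^*_K$, reject $e$; if $e \in I^*_K$ and there is no assignment of weights to the unseen candidates under which $e$ is not among the $r$ best candidates overall, accept $e$; otherwise postpone $e$. Expectations are over the random arrivals. *)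

theory Defs
  imports "HOL-Probability.Probability"
begin

text \<open>The candidates are \<open>0, \<dots>, n - 1\<close>; \<open>w\<close> assigns the weights.\<close>

definition valid_weights :: "nat \<Rightarrow> (nat \<Rightarrow> real) \<Rightarrow> bool" where
  "valid_weights n w \<longleftrightarrow> (\<forall>e<n. 0 < w e) \<and> inj_on w {..<n}"

definition max_weight_indep :: "nat \<Rightarrow> (nat \<Rightarrow> real) \<Rightarrow> nat set \<Rightarrow> nat set \<Rightarrow> bool" where
  "max_weight_indep r w K I \<longleftrightarrow> I \<subseteq> K \<and> card I \<le> r \<and>
     (\<forall>J. J \<subseteq> K \<and> card J \<le> r \<longrightarrow> sum w J \<le> sum w I)"

text \<open>\<open>opt r w K\<close> is $I^*_K$; it is well defined by lemma \<open>max_weight_indep_unique\<close> below.\<close>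

definition opt :: "nat \<Rightarrow> (nat \<Rightarrow> real) \<Rightarrow> nat set \<Rightarrow> nat set" where
  "opt r w K = (THE I. max_weight_indep r w K I)"

definition best :: "nat \<Rightarrow> (nat \<Rightarrow> real) \<Rightarrow> nat set \<Rightarrow> nat set" where
  "best r w S = {e \<in> S. card {f \<in> S. w e < w f} < r}"

definition jth_best :: "nat \<Rightarrow> (nat \<Rightarrow> real) \<Rightarrow> nat \<Rightarrow> nat" where
  "jth_best n w j = (THE e. e < n \<and> card {f. f < n \<and> w e < w f} + 1 = j)"

datatype decision = Accept | Reject | Postpone

text \<open>
  The decision on an arriving candidate \<open>e\<close>, where \<open>K\<close> is the set of candidates seen so far,
  including \<open>e\<close>. Only the weights of the candidates in \<open>K\<close> influence it.
\<close>

definition decide :: "nat \<Rightarrow> nat \<Rightarrow> (nat \<Rightarrow> real) \<Rightarrow> nat set \<Rightarrow> nat \<Rightarrow> decision" where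
  "decide n r w K e =
     (if e \<notin> opt r w K then Reject
      else if \<not> (\<exists>w'. valid_weights n w' \<and> (\<forall>f\<in>K. w' f = w f) \<and> e \<notin> best r w' {..<n}) then Accept
      else Postpone)"

text \<open>
  A state is a pair of the current pool and the set of candidates seen so far. The arrival in a
  step is \<open>Some e\<close>, or \<open>None\<close> once the pool is empty and the process is over.
\<close>

fun step :: "nat \<Rightarrow> nat \<Rightarrow> (nat \<Rightarrow> real) \<Rightarrow> nat set \<times> nat set \<Rightarrow> nat option \<Rightarrow> nat set \<times> nat set" where
  "step n r w (P, K) None = (P, K)"
| "step n r w (P, K) (Some e) =
     (if decide n r w (insert e K) e = Postpone then P else P - {e}, insert e K)"

definition state :: "nat \<Rightarrow> nat \<Rightarrow> (nat \<Rightarrow> real) \<Rightarrow> nat option list \<Rightarrow> nat set \<times> nat set" where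
  "state n r w xs = foldl (step n r w) ({..<n}, {}) xs"

definition pool :: "nat \<Rightarrow> nat \<Rightarrow> (nat \<Rightarrow> real) \<Rightarrow> nat option list \<Rightarrow> nat set" where
  "pool n r w xs = fst (state n r w xs)"

definition seen :: "nat \<Rightarrow> nat \<Rightarrow> (nat \<Rightarrow> real) \<Rightarrow> nat option list \<Rightarrow> nat set" where
  "seen n r w xs = snd (state n r w xs)"

definition next_arrival :: "nat \<Rightarrow> nat \<Rightarrow> (nat \<Rightarrow> real) \<Rightarrow> nat option list \<Rightarrow> nat option pmf" where
  "next_arrival n r w xs =
     (if pool n r w xs = {} then return_pmf None
      else map_pmf Some (pmf_of_set (pool n r w xs)))"

definition history :: "(nat \<Rightarrow> nat option) \<Rightarrow> nat \<Rightarrow> nat option list" where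
  "history \<omega> t = map \<omega> [0..<t]"

definition arrival_kernel ::
  "nat \<Rightarrow> nat \<Rightarrow> (nat \<Rightarrow> real) \<Rightarrow> nat \<Rightarrow> (nat \<Rightarrow> nat option) \<Rightarrow> nat option measure" where
  "arrival_kernel n r w t \<omega> = measure_pmf (next_arrival n r w (history \<omega> t))"

text \<open>
  The law of the whole sequence of arrivals, i.e. the measure on infinite sequences that the
  Ionescu-Tulcea theorem provides for the kernels above. See lemmas
  \<open>Ionescu_Tulcea_arrival_kernel\<close> and \<open>emeasure_arrival_process\<close>.
\<close>

definition arrival_process :: "nat \<Rightarrow> nat \<Rightarrow> (nat \<Rightarrow> real) \<Rightarrow> (nat \<Rightarrow> nat option) measure" where
  "arrival_process n r w =
     projective_family.lim UNIV
       (Ionescu_Tulcea.CI (arrival_kernel n r w) (\<lambda>_. count_space UNIV)) (\<lambda>_. count_space UNIV)"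

definition postponed_at ::
  "nat \<Rightarrow> nat \<Rightarrow> (nat \<Rightarrow> real) \<Rightarrow> nat \<Rightarrow> (nat \<Rightarrow> nat option) \<Rightarrow> nat \<Rightarrow> bool" where
  "postponed_at n r w e \<omega> t \<longleftrightarrow>
     \<omega> t = Some e \<and> decide n r w (insert e (seen n r w (history \<omega> t))) e = Postpone"

text \<open>The number of postponements of \<open>e\<close>; it takes the value \<open>\<infinity>\<close> if \<open>e\<close> is postponed forever.\<close>

definition postponements ::
  "nat \<Rightarrow> nat \<Rightarrow> (nat \<Rightarrow> real) \<Rightarrow> nat \<Rightarrow> (nat \<Rightarrow> nat option) \<Rightarrow> ennreal" where
  "postponements n r w e \<omega> = emeasure (count_space UNIV) {t. postponed_at n r w e \<omega> t}"

definition expected_postponements :: "nat \<Rightarrow> nat \<Rightarrow> (nat \<Rightarrow> real) \<Rightarrow> nat \<Rightarrow> ennreal" where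
  "expected_postponements n r w e =
     (\<integral>\<^sup>+ \<omega>. postponements n r w e \<omega> \<partial>arrival_process n r w)"

subsection \<open>Well-definedness\<close>

lemma max_weight_indep_imp_best:
  assumes fin: "finite K" and pos: "\<And>e. e \<in> K \<Longrightarrow> 0 < w e" and inj: "inj_on w K"
    and I: "max_weight_indep r w K I"
  shows "I = best r w K"
proof -
  have sub: "I \<subseteq> K" and cI: "card I \<le> r"
    and mx: "\<And>J. J \<subseteq> K \<Longrightarrow> card J \<le> r \<Longrightarrow> sum w J \<le> sum w I"
    using I by (auto simp: max_weight_indep_def)
  have finI: "finite I" using fin sub finite_subset by blast
  have swap: False if "f \<in> I" "e \<in> K" "e \<notin> I" "w f < w e" for e f
  proof -
    have "card (insert e (I - {f})) = card I"
      using card_Suc_Diff1[OF finI that(1)] that(3) finI by simp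
    hence "sum w (insert e (I - {f})) \<le> sum w I"
      using that sub cI by (intro mx) auto
    moreover have "sum w (insert e (I - {f})) = sum w I - w f + w e"
      using that finI by (subst sum.insert) (auto simp: sum_diff1)
    ultimately show False using that by simp
  qed
  show ?thesis
  proof (rule set_eqI, rule iffI)
    fix e assume e: "e \<in> I"
    have "card {f \<in> K. w e < w f} < r"
    proof (rule ccontr)
      assume "\<not> ?thesis"
      moreover have "{f \<in> K. w e < w f} \<subseteq> I - {e}" using swap[OF e] by auto
      hence "card {f \<in> K. w e < w f} \<le> card (I - {e})" using finI by (intro card_mono) auto
      moreover have "card (I - {e}) < card I" using e finI by (rule card_Diff1_less[rotated])
      ultimately show False using cI by linarith
    qed
    with e sub show "e \<in> best r w K" by (auto simp: best_def)
  next
    fix e assume e: "e \<in> best r w K"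
    show "e \<in> I"
    proof (rule ccontr)
      assume n: "e \<notin> I"
      have eK: "e \<in> K" and c: "card {f \<in> K. w e < w f} < r" using e by (auto simp: best_def)
      show False
      proof (cases "card I < r")
        case True
        hence "sum w (insert e I) \<le> sum w I"
          using eK sub n finI by (intro mx) auto
        thus False using n finI pos[OF eK] by simp
      next
        case False
        have "I \<subseteq> {f \<in> K. w e < w f}"
        proof
          fix f assume f: "f \<in> I"
          have "w f \<noteq> w e" using f n eK sub inj by (metis inj_on_eq_iff subsetD)
          with swap[OF f eK n] f sub show "f \<in> {f \<in> K. w e < w f}" by force
        qed
        hence "card I \<le> card {f \<in> K. w e < w f}" using fin by (intro card_mono) auto
        with c False show False by simp
      qed
    qed
  qed
qed

lemma max_weight_indep_unique:
  assumes fin: "finite K" and pos: "\<And>e. e \<in> K \<Longrightarrow> 0 < w e" and inj: "inj_on w K"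
  shows "\<exists>!I. max_weight_indep r w K I"
proof -
  let ?F = "{J. J \<subseteq> K \<and> card J \<le> r}"
  have "finite ?F" using fin by simp
  moreover have "?F \<noteq> {}" by (auto intro!: exI[of _ "{}"])
  ultimately have M: "Max (sum w ` ?F) \<in> sum w ` ?F" by (intro Max_in) auto
  then obtain I where "I \<in> ?F" and eq: "sum w I = Max (sum w ` ?F)" by auto
  moreover have "sum w J \<le> sum w I" if "J \<in> ?F" for J
    unfolding eq using that \<open>finite ?F\<close> by (intro Max_ge) auto
  ultimately have "max_weight_indep r w K I" by (auto simp: max_weight_indep_def)
  thus ?thesis
    by (metis max_weight_indep_imp_best[OF assms])
qed

lemma opt_eq_best:
  assumes "finite K" "\<And>e. e \<in> K \<Longrightarrow> 0 < w e" "inj_on w K"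
  shows "opt r w K = best r w K"
  unfolding opt_def
  by (rule max_weight_indep_imp_best[OF assms theI'[OF max_weight_indep_unique[OF assms]]])

lemma jth_best_unique:
  assumes w: "valid_weights n w" and j: "1 \<le> j" "j \<le> n"
  shows "\<exists>!e. e < n \<and> card {f. f < n \<and> w e < w f} + 1 = j"
proof -
  let ?c = "\<lambda>e. card {f. f < n \<and> w e < w f}"
  have inj: "inj_on w {..<n}" using w by (simp add: valid_weights_def)
  have less: "?c f < ?c e" if "e < n" "f < n" "w e < w f" for e f
    using that by (intro psubset_card_mono) (auto intro: less_trans)
  have inj_c: "inj_on ?c {..<n}"
  proof (rule inj_onI)
    fix e f assume ef: "e \<in> {..<n}" "f \<in> {..<n}" "?c e = ?c f"
    hence "w e = w f" using less[of e f] less[of f e] by (cases "w e" "w f" rule: linorder_cases) auto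
    thus "e = f" using inj ef by (auto dest: inj_onD)
  qed
  have "?c e < n" if "e < n" for e
  proof -
    have "?c e < card {..<n}" using that by (intro psubset_card_mono) auto
    thus ?thesis by simp
  qed
  hence "?c ` {..<n} \<subseteq> {..<n}" by auto
  moreover have "card (?c ` {..<n}) = n" using card_image[OF inj_c] by simp
  ultimately have im: "?c ` {..<n} = {..<n}" by (intro card_subset_eq) auto
  have "j - 1 \<in> ?c ` {..<n}" unfolding im using j by auto
  then obtain e where "e < n" "?c e = j - 1" by auto
  thus ?thesis using j inj_c by (intro ex1I[of _ e]) (auto dest: inj_onD)
qed

lemma history_measurable:
  assumes "{0..<t} \<subseteq> I"
  shows "(\<lambda>\<omega>. history \<omega> t) \<in> measurable (PiM I (\<lambda>_. count_space UNIV)) (count_space UNIV)"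
  using assms
proof (induction t)
  case 0
  show ?case by (simp add: history_def)
next
  case (Suc t)
  have [measurable]: "(\<lambda>\<omega>. history \<omega> t) \<in> measurable (PiM I (\<lambda>_. count_space UNIV)) (count_space UNIV)"
    by (rule Suc.IH) (use Suc.prems in \<open>auto simp: subset_iff\<close>)
  have [measurable]: "(\<lambda>\<omega>. \<omega> t) \<in> measurable (PiM I (\<lambda>_. count_space UNIV)) (count_space (UNIV :: nat option set))"
    using Suc.prems by (intro measurable_component_singleton) auto
  have eq: "history \<omega> (Suc t) = history \<omega> t @ [\<omega> t]" for \<omega> by (simp add: history_def)
  show ?case unfolding eq by measurable
qed

lemma Ionescu_Tulcea_arrival_kernel:
  "Ionescu_Tulcea (arrival_kernel n r w) (\<lambda>_. count_space UNIV)"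
proof (rule Ionescu_Tulcea.intro)
  fix t
  show "arrival_kernel n r w t \<in>
      measurable (PiM {0..<t} (\<lambda>_. count_space UNIV)) (subprob_algebra (count_space UNIV))"
    unfolding arrival_kernel_def[abs_def]
    by (rule measurable_compose[OF history_measurable]) (auto intro: measure_pmf_in_subprob_algebra)
next
  fix t \<omega>
  show "prob_space (arrival_kernel n r w t \<omega>)"
    unfolding arrival_kernel_def by (rule prob_space_measure_pmf)
qed

lemma sets_arrival_process:
  "sets (arrival_process n r w) = sets (PiM UNIV (\<lambda>_. count_space UNIV))"
proof -
  interpret Ionescu_Tulcea "arrival_kernel n r w" "\<lambda>_. count_space UNIV"
    by (rule Ionescu_Tulcea_arrival_kernel)
  show ?thesis unfolding arrival_process_def by (simp only: PF.sets_lim)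
qed

lemma emeasure_arrival_process:
  assumes "finite J" "X \<in> sets (PiM J (\<lambda>_. count_space UNIV))"
  shows "emeasure (arrival_process n r w) (prod_emb UNIV (\<lambda>_. count_space UNIV) J X) =
         emeasure (Ionescu_Tulcea.CI (arrival_kernel n r w) (\<lambda>_. count_space UNIV) J) X"
proof -
  interpret Ionescu_Tulcea "arrival_kernel n r w" "\<lambda>_. count_space UNIV"
    by (rule Ionescu_Tulcea_arrival_kernel)
  show ?thesis unfolding arrival_process_def by (rule lim[OF assms])
qed

lemma prob_space_arrival_process: "prob_space (arrival_process n r w)"
proof -
  interpret Ionescu_Tulcea "arrival_kernel n r w" "\<lambda>_. count_space UNIV"
    by (rule Ionescu_Tulcea_arrival_kernel)
  interpret C: prob_space "CI {}" by (rule PF.prob_space_P) simp_all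
  have sp: "space (CI {}) = space (PiM {} (\<lambda>_. count_space UNIV))"
    unfolding CI_def by simp
  have "emeasure (arrival_process n r w)
      (prod_emb UNIV (\<lambda>_. count_space UNIV) {} (space (PiM {} (\<lambda>_. count_space UNIV)))) = 1"
    using C.emeasure_space_1 by (subst emeasure_arrival_process) (auto simp: sp)
  moreover have "prod_emb UNIV (\<lambda>_. count_space UNIV) {} (space (PiM {} (\<lambda>_. count_space UNIV)))
      = space (arrival_process n r w)"
    using sets_eq_imp_space_eq[OF sets_arrival_process] by (auto simp: prod_emb_def space_PiM restrict_def)
  ultimately show ?thesis by (intro prob_spaceI) simp
qed

lemma postponed_at_measurable [measurable]:
  "Measurable.pred (arrival_process n r w) (\<lambda>\<omega>. postponed_at n r w e \<omega> t)"
proof -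
  have [measurable]: "(\<lambda>\<omega>. history \<omega> t) \<in>
      measurable (PiM UNIV (\<lambda>_. count_space UNIV)) (count_space UNIV)"
    by (rule history_measurable) simp
  have "Measurable.pred (PiM UNIV (\<lambda>_. count_space UNIV)) (\<lambda>\<omega>. postponed_at n r w e \<omega> t)"
    unfolding postponed_at_def by measurable
  thus ?thesis using measurable_cong_sets[OF sets_arrival_process refl] by blast
qed

lemma postponements_eq_suminf:
  "postponements n r w e \<omega> = (\<Sum>t. indicator {t. postponed_at n r w e \<omega> t} t)"
  unfolding postponements_def
  by (subst nn_integral_indicator[symmetric]) (auto simp: nn_integral_count_space_nat)

lemma postponements_measurable [measurable]:
  "postponements n r w e \<in> borel_measurable (arrival_process n r w)"
proof -
  have "(\<lambda>\<omega>. \<Sum>t. indicator {t. postponed_at n r w e \<omega> t} t :: ennreal)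
      \<in> borel_measurable (arrival_process n r w)"
    unfolding indicator_def by measurable
  thus ?thesis by (simp add: postponements_eq_suminf[abs_def])
qed

end

theory Submission
  imports Defs
begin

text \<open>
  Let \<open>S\<close> be the set of candidates worse (if \<open>j \<le> r\<close>) or better (if \<open>j > r\<close>) than the
  \<open>j\<close>-th best candidate \<open>e\<close>. A postponement of \<open>e\<close> requires at least \<open>m\<close> unseen
  elements of \<open>S\<close>, where \<open>m\<close> is \<open>r - j + 1\<close> or \<open>j - r\<close>, respectively. While exactly \<open>y\<close>
  elements of \<open>S\<close> are unseen, each of them is as likely to arrive next as \<open>e\<close>, so \<open>e\<close> arrives
  at most \<open>1 / y\<close> times in expectation before \<open>y\<close> drops. Hence
  \<open>1 / m + \<dots> + 1 / card S\<close> bounds the expectation. Formally, the partial sum up to the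
  current value of \<open>y\<close> is a potential whose expected decrease pays for each postponement.
\<close>

section \<open>Integration over the arrival process, one step at a time\<close>

lemma nn_integral_Ionescu_Tulcea_lim:
  assumes IT: "Ionescu_Tulcea P M" and f: "f \<in> borel_measurable (PiM {0..<t} M)"
  shows "(\<integral>\<^sup>+\<omega>. f (restrict \<omega> {0..<t}) \<partial>projective_family.lim UNIV (Ionescu_Tulcea.CI P M) M) =
    (\<integral>\<^sup>+\<omega>. f \<omega> \<partial>Ionescu_Tulcea.C P M 0 t (\<lambda>_. undefined))"
proof -
  interpret Ionescu_Tulcea P M by (rule IT)
  \<comment> \<open>\<open>CI J\<close> is the projection to \<open>J\<close> of the law of the
    first \<open>up_to J\<close> coordinates; for an initial segment the projection changes
    nothing.\<close>
  have "up_to {0..<t} = t"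
    unfolding up_to_def by (rule Least_equality) (auto simp: not_less[symmetric])
  moreover have "distr (C 0 t (\<lambda>_. undefined)) (PiM {0..<t} M) (\<lambda>f. restrict f {0..<t}) =
      C 0 t (\<lambda>_. undefined)"
    using distr_C[of t t "\<lambda>_. undefined" 0] by simp
  ultimately have CI: "CI {0..<t} = C 0 t (\<lambda>_. undefined)" by (simp add: CI_def)
  have "(\<lambda>\<omega>. restrict \<omega> {0..<t}) \<in> measurable PF.lim (PiM {0..<t} M)"
    by (subst measurable_cong_sets[OF PF.sets_lim refl]) (rule measurable_restrict_subset, simp)
  then have "(\<integral>\<^sup>+\<omega>. f (restrict \<omega> {0..<t}) \<partial>PF.lim) =
      (\<integral>\<^sup>+\<omega>. f \<omega> \<partial>distr PF.lim (PiM {0..<t} M) (\<lambda>\<omega>. restrict \<omega> {0..<t}))"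
    by (simp add: nn_integral_distr f)
  then show ?thesis by (simp add: distr_lim CI)
qed

text \<open>\<open>C 0 (Suc t)\<close> is the bind of \<open>C 0 t\<close> with the kernel that
  appends a draw from \<open>P t\<close>, so the integral iterates.\<close>

lemma nn_integral_Ionescu_Tulcea_C_Suc:
  assumes IT: "Ionescu_Tulcea P M" and f: "f \<in> borel_measurable (PiM {0..<Suc t} M)"
  shows "(\<integral>\<^sup>+\<omega>. f \<omega> \<partial>Ionescu_Tulcea.C P M 0 (Suc t) (\<lambda>_. undefined)) =
    (\<integral>\<^sup>+\<omega>. \<integral>\<^sup>+x. f (fun_upd \<omega> t x) \<partial>P t \<omega> \<partial>Ionescu_Tulcea.C P M 0 t (\<lambda>_. undefined))"
proof -
  interpret Ionescu_Tulcea P M by (rule IT)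
  have u: "(\<lambda>_. undefined) \<in> space (PiM {0..<0} M)" by simp
  have e: "eP t \<in> measurable (C 0 t (\<lambda>_. undefined)) (subprob_algebra (PiM {0..<Suc t} M))"
    by (subst measurable_cong_sets[OF sets_C[OF u] refl]) simp
  show ?thesis
    using f e
    by (auto simp: nn_integral_bind[where B="PiM {0..<Suc t} M"] space_C[OF u] nn_integral_eP
        intro!: nn_integral_cong)
qed

lemma history_restrict: "history (restrict \<omega> {0..<t}) t = history \<omega> t"
  by (simp add: history_def)

lemma history_upd: "history (fun_upd \<omega> t x) (Suc t) = history \<omega> t @ [x]"
  by (simp add: history_def)

lemma history_Suc: "history \<omega> (Suc t) = history \<omega> t @ [\<omega> t]"
  by (simp add: history_def)

text \<open>The tower property: conditioning on the first \<open>t\<close> arrivals turns expected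
  drift into a one-step computation.\<close>

lemma nn_integral_history_Suc:
  "(\<integral>\<^sup>+\<omega>. f (history \<omega> (Suc t)) \<partial>arrival_process n r w) =
   (\<integral>\<^sup>+\<omega>. \<integral>\<^sup>+x. f (history \<omega> t @ [x]) \<partial>next_arrival n r w (history \<omega> t) \<partial>arrival_process n r w)"
proof -
  interpret Ionescu_Tulcea "arrival_kernel n r w" "\<lambda>_. count_space UNIV"
    by (rule Ionescu_Tulcea_arrival_kernel)
  let ?u = "\<lambda>_::nat. undefined :: nat option"
  have lim: "(\<integral>\<^sup>+\<omega>. g (history \<omega> t) \<partial>arrival_process n r w) =
      (\<integral>\<^sup>+\<omega>. g (history \<omega> t) \<partial>C 0 t ?u)" for g :: "nat option list \<Rightarrow> ennreal" and t
  proof -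
    have "(\<lambda>\<omega>. g (history \<omega> t)) \<in> borel_measurable (PiM {0..<t} (\<lambda>_. count_space UNIV))"
      by (rule measurable_compose[OF history_measurable]) auto
    from nn_integral_Ionescu_Tulcea_lim[OF Ionescu_Tulcea_arrival_kernel this] show ?thesis
      by (simp only: arrival_process_def history_restrict)
  qed
  have "(\<lambda>\<omega>. f (history \<omega> (Suc t))) \<in>
      borel_measurable (PiM {0..<Suc t} (\<lambda>_. count_space UNIV))"
    by (rule measurable_compose[OF history_measurable]) auto
  from nn_integral_Ionescu_Tulcea_C_Suc[OF Ionescu_Tulcea_arrival_kernel this] show ?thesis
    by (simp only: lim lim[where g="\<lambda>xs. \<integral>\<^sup>+x. f (xs @ [x]) \<partial>next_arrival n r w xs"]
        history_upd arrival_kernel_def)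
qed

text \<open>The hypothesis telescopes: the expected reward of the first \<open>T\<close> steps plus
  the expected value of \<open>V\<close> after them is at most \<open>V []\<close>. Drop the
  nonnegative \<open>V\<close> term and let \<open>T\<close> tend to infinity.\<close>

lemma supermartingale_bound:
  fixes V :: "nat option list \<Rightarrow> ennreal"
  assumes "\<And>xs. (\<integral>\<^sup>+x. (g xs x + V (xs @ [x])) \<partial>next_arrival n r w xs) \<le> V xs"
  shows "(\<integral>\<^sup>+\<omega>. (\<Sum>t. g (history \<omega> t) (\<omega> t)) \<partial>arrival_process n r w) \<le> V []"
proof -
  let ?A = "arrival_process n r w"
  interpret A: prob_space ?A by (rule prob_space_arrival_process)
  have hist [measurable]: "(\<lambda>\<omega>. history \<omega> t) \<in> measurable ?A (count_space UNIV)" for t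
    by (subst measurable_cong_sets[OF sets_arrival_process refl]) (rule history_measurable, simp)
  have [measurable]: "(\<lambda>\<omega>. \<omega> t) \<in> measurable ?A (count_space UNIV)" for t
    by (subst measurable_cong_sets[OF sets_arrival_process refl])
      (rule measurable_component_singleton, simp)
  \<comment> \<open>As a function of the longer history alone, the reward fits
    \<open>nn_integral_history_Suc\<close>.\<close>
  have g_last: "g (history \<omega> t) (\<omega> t) =
      (\<lambda>xs. g (butlast xs) (last xs)) (history \<omega> (Suc t))" for \<omega> t
    by (simp add: history_Suc)
  have g_meas [measurable]: "(\<lambda>\<omega>. g (history \<omega> t) (\<omega> t)) \<in> borel_measurable ?A" for t
    unfolding g_last by measurable
  have partial: "(\<Sum>t<T. \<integral>\<^sup>+\<omega>. g (history \<omega> t) (\<omega> t) \<partial>?A) +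
      (\<integral>\<^sup>+\<omega>. V (history \<omega> T) \<partial>?A) \<le> V []" for T
  proof (induction T)
    case 0
    then show ?case by (simp add: history_def A.emeasure_space_1)
  next
    case (Suc T)
    let ?f = "\<lambda>xs. g (butlast xs) (last xs) + V xs"
    have "(\<integral>\<^sup>+\<omega>. g (history \<omega> T) (\<omega> T) \<partial>?A) + (\<integral>\<^sup>+\<omega>. V (history \<omega> (Suc T)) \<partial>?A) =
        (\<integral>\<^sup>+\<omega>. ?f (history \<omega> (Suc T)) \<partial>?A)"
      by (subst nn_integral_add[symmetric]) (auto simp: g_last)
    also have "\<dots> = (\<integral>\<^sup>+\<omega>. \<integral>\<^sup>+x. ?f (history \<omega> T @ [x]) \<partial>next_arrival n r w (history \<omega> T) \<partial>?A)"
      by (rule nn_integral_history_Suc)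
    also have "\<dots> \<le> (\<integral>\<^sup>+\<omega>. V (history \<omega> T) \<partial>?A)"
      using assms by (intro nn_integral_mono) simp
    finally show ?case
      using Suc.IH by (simp add: add.assoc) (meson add_left_mono order_trans)
  qed
  have "(\<integral>\<^sup>+\<omega>. (\<Sum>t. g (history \<omega> t) (\<omega> t)) \<partial>?A) =
      (\<Sum>t. \<integral>\<^sup>+\<omega>. g (history \<omega> t) (\<omega> t) \<partial>?A)"
    by (rule nn_integral_suminf) simp
  also have "\<dots> = (SUP T. \<Sum>t<T. \<integral>\<^sup>+\<omega>. g (history \<omega> t) (\<omega> t) \<partial>?A)"
    by (rule suminf_eq_SUP)
  also have "\<dots> \<le> V []"
  proof (rule SUP_least)
    fix T
    show "(\<Sum>t<T. \<integral>\<^sup>+\<omega>. g (history \<omega> t) (\<omega> t) \<partial>?A) \<le> V []"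
      by (rule order_trans[OF _ partial[of T]]) simp
  qed
  finally show ?thesis .
qed

section \<open>Evolution of the pool and the seen set\<close>

lemma state_snoc: "state n r w (xs @ [x]) = step n r w (state n r w xs) x"
  by (simp add: state_def)

lemma seen_snoc_Some: "seen n r w (xs @ [Some x]) = insert x (seen n r w xs)"
  by (cases "state n r w xs") (simp add: seen_def state_snoc)

lemma seen_snoc_None: "seen n r w (xs @ [None]) = seen n r w xs"
  by (cases "state n r w xs") (simp add: seen_def state_snoc)

lemma pool_subset: "pool n r w xs \<subseteq> {..<n}"
proof (induction xs rule: rev_induct)
  case (snoc x xs)
  then show ?case
    by (cases "state n r w xs"; cases x) (auto simp: pool_def state_snoc)
qed (simp add: pool_def state_def)

text \<open>Only an arrival removes a candidate. Hence every unseen candidate can still be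
  drawn.\<close>

lemma unseen_subset_pool: "{..<n} - seen n r w xs \<subseteq> pool n r w xs"
proof (induction xs rule: rev_induct)
  case (snoc x xs)
  then show ?case
    by (cases "state n r w xs"; cases x) (auto simp: pool_def seen_def state_snoc)
qed (simp add: pool_def seen_def state_def)

section \<open>The potential argument\<close>

text \<open>Let \<open>y\<close> elements of \<open>S\<close> be unseen and
  \<open>m \<le> y\<close>. From a pool \<open>P\<close>, \<open>e\<close> arrives with probability
  at most \<open>1 / card P\<close> and costs at most 1; an unseen element of \<open>S\<close>
  arrives with probability \<open>y / card P\<close> and lowers the potential by
  \<open>1 / y\<close>. These balance. For \<open>y < m\<close>, no postponement of \<open>e\<close>
  can occur and the potential is 0.\<close>

lemma expected_postponements_le:
  fixes S :: "nat set" and m :: nat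
  assumes S: "S \<subseteq> {..<n}" and m: "m \<ge> 1"
    and postpone: "\<And>K. \<lbrakk>K \<subseteq> {..<n}; e \<in> K; decide n r w K e = Postpone\<rbrakk> \<Longrightarrow> m \<le> card (S - K)"
    and e: "e \<notin> S"
  shows "expected_postponements n r w e \<le> ennreal (\<Sum>i=m..card S. 1 / real i)"
proof -
  define \<Phi> where "\<Phi> K = (\<Sum>i=m..card (S - K). 1 / real i)" for K
  \<comment> \<open>The value \<open>\<top>\<close> makes the drift inequality trivial on null histories, where \<open>opt\<close> may be junk.\<close>
  define V where "V xs = (if seen n r w xs \<subseteq> {..<n} then ennreal (\<Phi> (seen n r w xs)) else \<top>)" for xs
  define g :: "nat option list \<Rightarrow> nat option \<Rightarrow> ennreal" where
    "g xs x = of_bool (x = Some e \<and> decide n r w (insert e (seen n r w xs)) e = Postpone)" for xs x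
  have fin: "finite S" using S finite_subset by blast
  have \<Phi>_nonneg: "0 \<le> \<Phi> K" for K
    unfolding \<Phi>_def by (intro sum_nonneg) auto
  have drift: "(\<integral>\<^sup>+x. (g xs x + V (xs @ [x])) \<partial>next_arrival n r w xs) \<le> V xs" for xs
  proof (cases "seen n r w xs \<subseteq> {..<n}")
    case False
    then show ?thesis by (simp add: V_def)
  next
    case K_sub: True
    define K where "K = seen n r w xs"
    define P where "P = pool n r w xs"
    define y where "y = card (S - K)"
    have VK: "V xs = ennreal (\<Phi> K)" using K_sub by (simp add: V_def K_def)
    show ?thesis
    proof (cases "P = {}")
      case True
      then show ?thesis
        using K_sub by (simp add: next_arrival_def P_def g_def V_def seen_snoc_None)
    next
      case False
      have P: "P \<subseteq> {..<n}" "S - K \<subseteq> P" "finite P"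
        using pool_subset[of n r w xs] unseen_subset_pool[of n r w xs] S
        by (auto simp: P_def K_def intro: finite_subset)
      have K: "K \<subseteq> {..<n}" using K_sub by (simp add: K_def)
      \<comment> \<open>\<open>d x\<close> bounds reward plus change of potential when
        \<open>x\<close> arrives. It charges every arrival of \<open>e\<close> while
        \<open>m \<le> y\<close>, postponed or not.\<close>
      define d where "d x = (of_bool (m \<le> y) * (of_bool (x = e) - of_bool (x \<in> S - K) / real y) :: real)" for x
      \<comment> \<open>Nonnegativity is carried along so that \<open>sum_ennreal\<close> can move
        the sum into the reals.\<close>
      have d: "g xs (Some x) + V (xs @ [Some x]) \<le> ennreal (\<Phi> K + d x) \<and> 0 \<le> \<Phi> K + d x"
        if x: "x \<in> P" for x
      proof -
        have \<Phi>': "\<Phi> (insert x K) = \<Phi> K - of_bool (m \<le> y \<and> x \<in> S - K) / real y"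
        proof (cases "x \<in> S - K")
          case True
          have "S - insert x K = (S - K) - {x}" by auto
          with True fin have c: "card (S - insert x K) = y - 1" "y \<ge> 1"
            by (auto simp: y_def Suc_le_eq card_gt_0_iff)
          then have "{m..y} = (if m \<le> y then insert y {m..y - 1} else {})" by auto
          moreover have "{m..y - 1} = {}" if "\<not> m \<le> y" using that by auto
          moreover have "y \<notin> {m..y - 1}" using c by auto
          ultimately show ?thesis
            using True c by (auto simp: \<Phi>_def y_def[symmetric])
        next
          case False
          then have "S - insert x K = S - K" by auto
          with False show ?thesis by (simp add: \<Phi>_def)
        qed
        have g: "g xs (Some x) \<le> ennreal (of_bool (m \<le> y \<and> x = e))"
        proof (cases "x = e \<and> decide n r w (insert e K) e = Postpone")
          case True
          then have "m \<le> card (S - insert e K)"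
            using x P K by (intro postpone) auto
          \<comment> \<open>The decision is made after \<open>e\<close> joins the seen set, which
            leaves \<open>y\<close> unchanged.\<close>
          also have "S - insert e K = S - K" using e by auto
          finally show ?thesis by (simp add: g_def y_def)
        qed (simp add: g_def K_def)
        have V': "V (xs @ [Some x]) = ennreal (\<Phi> (insert x K))"
          using K P x by (auto simp: V_def seen_snoc_Some K_def[symmetric])
        have eq: "of_bool (m \<le> y \<and> x = e) + \<Phi> (insert x K) = \<Phi> K + d x"
          unfolding \<Phi>' d_def by (auto simp: of_bool_def)
        have "g xs (Some x) + V (xs @ [Some x]) \<le>
            ennreal (of_bool (m \<le> y \<and> x = e)) + ennreal (\<Phi> (insert x K))"
          unfolding V' by (intro add_right_mono g)
        also have "\<dots> = ennreal (\<Phi> K + d x)"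
          unfolding eq[symmetric] by (rule ennreal_plus[symmetric]) (auto simp: \<Phi>_nonneg)
        finally have "g xs (Some x) + V (xs @ [Some x]) \<le> ennreal (\<Phi> K + d x)" .
        moreover have "0 \<le> \<Phi> K + d x"
          unfolding eq[symmetric] using \<Phi>_nonneg[of "insert x K"] by simp
        ultimately show ?thesis by simp
      qed
      have "(\<Sum>x\<in>P. d x) = of_bool (m \<le> y) * ((\<Sum>x\<in>P. of_bool (x = e)) - (\<Sum>x\<in>P. of_bool (x \<in> S - K)) / real y)"
        by (simp add: d_def sum_subtractf sum_distrib_left sum_divide_distrib right_diff_distrib)
      also have "(\<Sum>x\<in>P. of_bool (x = e)) = (of_bool (e \<in> P) :: real)"
        using P by (simp add: of_bool_def)
      also have "(\<Sum>x\<in>P. of_bool (x \<in> S - K)) = real y"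
        using P by (simp add: sum.If_cases of_bool_def y_def Int_absorb1 Int_commute del: Diff_iff)
      \<comment> \<open>Since \<open>m\<close> is at least 1, \<open>y\<close> is positive whenever
        the first factor is nonzero, so \<open>y / y\<close> is then 1.\<close>
      also have "of_bool (m \<le> y) * (of_bool (e \<in> P) - real y / real y) \<le> 0"
        using m by (cases "y = 0") auto
      finally have d_sum: "(\<Sum>x\<in>P. d x) \<le> 0" .
      have "(\<integral>\<^sup>+x. (g xs x + V (xs @ [x])) \<partial>next_arrival n r w xs) =
          (\<Sum>x\<in>P. g xs (Some x) + V (xs @ [Some x])) / card P"
        using False P by (simp add: next_arrival_def P_def[symmetric] nn_integral_pmf_of_set)
      also have "\<dots> \<le> (\<Sum>x\<in>P. ennreal (\<Phi> K + d x)) / card P"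
        using d by (intro divide_right_mono_ennreal sum_mono) auto
      also have "(\<Sum>x\<in>P. ennreal (\<Phi> K + d x)) = ennreal (\<Sum>x\<in>P. \<Phi> K + d x)"
        using d by (intro sum_ennreal) auto
      also have "\<dots> / card P \<le> ennreal (card P * \<Phi> K) / card P"
        using d_sum by (intro divide_right_mono_ennreal ennreal_leI) (simp add: sum.distrib)
      also have "\<dots> = ennreal (\<Phi> K)"
        using False P \<Phi>_nonneg[of K]
        by (simp add: ennreal_of_nat_eq_real_of_nat divide_ennreal card_gt_0_iff)
      finally show ?thesis by (simp add: VK)
    qed
  qed
  have "expected_postponements n r w e =
      (\<integral>\<^sup>+\<omega>. (\<Sum>t. g (history \<omega> t) (\<omega> t)) \<partial>arrival_process n r w)"
    unfolding expected_postponements_def postponements_eq_suminf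
    by (intro nn_integral_cong suminf_cong) (auto simp: g_def postponed_at_def)
  also have "\<dots> \<le> V []"
    by (rule supermartingale_bound[OF drift])
  also have "V [] = ennreal (\<Sum>i=m..card S. 1 / real i)"
    by (simp add: V_def \<Phi>_def seen_def state_def)
  finally show ?thesis .
qed

section \<open>Harmonic sums and logarithms\<close>

text \<open>Each term after the first is at most an increment of \<open>ln\<close>; the first term
  \<open>1 / m\<close> is at most 1.\<close>

lemma sum_inverse_le_ln:
  fixes m N :: nat
  assumes "1 \<le> m" "m \<le> N"
  shows "(\<Sum>i=m..N. 1 / real i) \<le> ln (real N / real m) + 1"
  using assms(2)
proof (induction rule: dec_induct)
  case base
  then show ?case using assms(1) by simp
next
  case (step N)
  have "ln (real N) - ln (real (Suc N)) \<le> (real N - real (Suc N)) / real (Suc N)"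
    using assms step by (intro ln_diff_le) auto
  then have "1 / real (Suc N) \<le> ln (real (Suc N) / real m) - ln (real N / real m)"
    using assms step by (simp add: ln_div)
  with step show ?case by simp
qed

section \<open>Unseen candidates forced by a postponement\<close>

text \<open>Some completion \<open>w'\<close> of the seen weights puts at least \<open>r\<close>
  candidates above \<open>e\<close>. Seen ones among them are truly better than \<open>e\<close>, so
  any truly worse ones are unseen.\<close>

lemma postpone_imp_unseen_worse:
  assumes w: "valid_weights n w" and K: "K \<subseteq> {..<n}" "e \<in> K"
    and D: "decide n r w K e = Postpone"
  shows "r \<le> card {f. f < n \<and> w e < w f} + card ({f. f < n \<and> w f < w e} - K)"
proof -
  let ?B = "{f. f < n \<and> w e < w f}" and ?S = "{f. f < n \<and> w f < w e}"
  obtain w' where w': "\<forall>f\<in>K. w' f = w f" "e \<notin> best r w' {..<n}"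
    using D by (auto simp: decide_def split: if_splits)
  have "r \<le> card {f \<in> {..<n}. w' e < w' f}"
    using w'(2) K by (auto simp: best_def)
  also have "\<dots> \<le> card (?B \<union> (?S - K))"
  proof (intro card_mono subsetI)
    fix f assume f: "f \<in> {f \<in> {..<n}. w' e < w' f}"
    show "f \<in> ?B \<union> (?S - K)"
    proof (cases "f \<in> K")
      case True
      with f w' K show ?thesis by auto
    next
      case False
      with K have "f \<noteq> e" by auto
      with f K w have "w f \<noteq> w e" by (auto simp: valid_weights_def dest: inj_onD)
      with f False show ?thesis by auto
    qed
  qed simp
  also have "\<dots> \<le> card ?B + card (?S - K)" by (rule card_Un_le)
  finally show ?thesis .
qed

text \<open>A postponed \<open>e\<close> is among the \<open>r\<close> best seen, so fewer than
  \<open>r\<close> better candidates have been seen.\<close>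

lemma postpone_imp_unseen_better:
  assumes w: "valid_weights n w" and K: "K \<subseteq> {..<n}" "e \<in> K"
    and D: "decide n r w K e = Postpone"
  shows "card {f. f < n \<and> w e < w f} < r + card ({f. f < n \<and> w e < w f} - K)"
proof -
  let ?B = "{f. f < n \<and> w e < w f}"
  have "e \<in> opt r w K" using D by (auto simp: decide_def split: if_splits)
  also have "opt r w K = best r w K"
    using w K by (intro opt_eq_best) (auto simp: valid_weights_def intro: finite_subset inj_on_subset)
  finally have "card {f \<in> K. w e < w f} < r" by (simp add: best_def)
  moreover have "?B = {f \<in> K. w e < w f} \<union> (?B - K)" using K by auto
  then have "card ?B \<le> card {f \<in> K. w e < w f} + card (?B - K)" by (metis card_Un_le)
  ultimately show ?thesis by linarith
qed

theorem theorem9: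
  shows "\<exists>C::real. \<forall>(n::nat) (r::nat) (w::nat \<Rightarrow> real) (j::nat).
    1 \<le> r \<longrightarrow> real r \<le> real n / 2 \<longrightarrow> valid_weights n w \<longrightarrow> j \<in> {1..n} \<longrightarrow>
      expected_postponements n r w (jth_best n w j) \<le>
        ennreal (if j \<le> r then ln ((real n - real j) / (real r - real j + 1)) + C
                 else ln ((real j - 1) / (real j - real r)) + C)"
proof (intro exI[of _ 1] allI impI)
  \<comment> \<open>The witness 1 for \<open>C\<close> is the additive constant of
    \<open>sum_inverse_le_ln\<close>.\<close>
  fix n r :: nat and w :: "nat \<Rightarrow> real" and j :: nat
  assume r: "1 \<le> r" "real r \<le> real n / 2" and w: "valid_weights n w" and j: "j \<in> {1..n}"
  define e where "e = jth_best n w j"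
  define B where "B = {f. f < n \<and> w e < w f}"
  define S where "S = {f. f < n \<and> w f < w e}"
  have e: "e < n" "card B + 1 = j"
    using theI'[OF jth_best_unique[OF w, of j]] j by (auto simp: e_def jth_best_def B_def)
  have fin: "finite B" "finite S" by (auto simp: B_def S_def)
  have disj: "e \<notin> B" "e \<notin> S" "B \<inter> S = {}" by (auto simp: B_def S_def)
  have sub: "B \<subseteq> {..<n}" "S \<subseteq> {..<n}" by (auto simp: B_def S_def)
  have part: "{..<n} = insert e (B \<union> S)"
  proof -
    have "f = e \<or> w e < w f \<or> w f < w e" if "f < n" for f
      using that e(1) w inj_onD[of w "{..<n}" f e]
      by (cases "w f" "w e" rule: linorder_cases) (auto simp: valid_weights_def)
    then show ?thesis using e(1) by (auto simp: B_def S_def)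
  qed
  have "n = Suc (card B + card S)"
    using arg_cong[OF part, of card] fin disj by (simp add: card_Un_disjoint)
  then have card_S: "card S = n - j" using e by simp
  show "expected_postponements n r w (jth_best n w j) \<le>
        ennreal (if j \<le> r then ln ((real n - real j) / (real r - real j + 1)) + 1
                 else ln ((real j - 1) / (real j - real r)) + 1)"
  proof (cases "j \<le> r")
    case True
    have "expected_postponements n r w e \<le> ennreal (\<Sum>i=r-j+1..card S. 1 / real i)"
    proof (rule expected_postponements_le)
      fix K assume "K \<subseteq> {..<n}" "e \<in> K" "decide n r w K e = Postpone"
      from postpone_imp_unseen_worse[OF w this] show "r - j + 1 \<le> card (S - K)"
        using e(2) True by (simp add: B_def S_def)
    qed (use sub disj in auto)
    \<comment> \<open>The lower limit \<open>r - j + 1\<close> is at most \<open>n - j\<close>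
      because \<open>1 \<le> r\<close> and \<open>r \<le> n / 2\<close> give
      \<open>r < n\<close>.\<close>
    also have "(\<Sum>i=r-j+1..card S. 1 / real i) \<le> ln (real (card S) / real (r - j + 1)) + 1"
      using r j True card_S by (intro sum_inverse_le_ln) auto
    also have "real (card S) / real (r - j + 1) = (real n - real j) / (real r - real j + 1)"
      using True j by (simp add: card_S add.commute)
    finally show ?thesis using True by (simp add: e_def ennreal_leI)
  next
    case False
    have "expected_postponements n r w e \<le> ennreal (\<Sum>i=j-r..card B. 1 / real i)"
    proof (rule expected_postponements_le)
      fix K assume "K \<subseteq> {..<n}" "e \<in> K" "decide n r w K e = Postpone"
      from postpone_imp_unseen_better[OF w this] show "j - r \<le> card (B - K)"
        using e(2) by (simp add: B_def)
    qed (use sub disj False in auto)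
    \<comment> \<open>Here \<open>1 \<le> r\<close> gives \<open>j - r \<le> j - 1\<close>, the
      cardinality of \<open>B\<close>.\<close>
    also have "(\<Sum>i=j-r..card B. 1 / real i) \<le> ln (real (card B) / real (j - r)) + 1"
      using r False e(2) by (intro sum_inverse_le_ln) auto
    also have "real (card B) / real (j - r) = (real j - 1) / (real j - real r)"
      using e(2) False by (simp flip: e(2))
    finally show ?thesis using False by (simp add: e_def ennreal_leI)
  qed
qed

end
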